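(* Let $k$ be a positive integer. Then $\gamma_k^{\mathrm L}(K_{k+2}\square K_{k+2})=2(k+2)$.
   Context: All graphs are finite and simple; $N_G(u)$ is the open neighborhood of $u$ in $G$, and $K_m$ is the complete graph on $m$ vertices. A set $D\subseteq V(G)$ is a dominating set if every vertex of $V(G)\setminus D$ has a neighbor in $D$. For an integer $k\ge 0$, a dominating set $D$ of $G$ is a $k$-limited dominating set if $|N_G(u)\setminus D|\le k$ for every $u\in D$. The $k$-limited domination number $\gamma_k^{\mathrm L}(G)$ is the minimum cardinality of a $k$-limited dominating set of $G$. The Cartesian product $G\square H$ has vertex set $V(G)\times V(H)$, with $(g,h)$ and $(g',h')$ adjacent if and only if either $g=g'$ and $hh'\in E(H)$, or $h=h'$ and $gg'\in E(G)$. *)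

theory Defs
  imports "Graph_Theory.Graph_Theory"
begin

text \<open>
  A finite simple graph is a \<^locale>\<open>pair_graph\<close>: a finite vertex set with a symmetric, irreflexive
  set of arcs, an edge \<open>uv\<close> being the two arcs \<open>(u, v)\<close> and \<open>(v, u)\<close>. The graph \<open>K\<^sub>m\<close> is given by
  \<^const>\<open>complete_digraph\<close>, a property determining \<open>G\<close> up to the names of its vertices.
\<close>

definition open_neighborhood :: "'a pair_pre_digraph \<Rightarrow> 'a \<Rightarrow> 'a set" where
  "open_neighborhood G u = {v \<in> pverts G. (u, v) \<in> parcs G}"

definition dominating_set :: "'a pair_pre_digraph \<Rightarrow> 'a set \<Rightarrow> bool" where
  "dominating_set G D \<longleftrightarrow>
     D \<subseteq> pverts G \<and> (\<forall>v \<in> pverts G - D. \<exists>u \<in> D. u \<in> open_neighborhood G v)"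

definition limited_dominating_set :: "nat \<Rightarrow> 'a pair_pre_digraph \<Rightarrow> 'a set \<Rightarrow> bool" where
  "limited_dominating_set k G D \<longleftrightarrow>
     dominating_set G D \<and> (\<forall>u \<in> D. card (open_neighborhood G u - D) \<le> k)"

text \<open>The minimum exists, since \<open>V(G)\<close> itself is a \<open>k\<close>-limited dominating set.\<close>

definition limited_domination_number :: "nat \<Rightarrow> 'a pair_pre_digraph \<Rightarrow> nat" where
  "limited_domination_number k G = (LEAST n. \<exists>D. limited_dominating_set k G D \<and> card D = n)"

definition cartesian_product ::
    "'a pair_pre_digraph \<Rightarrow> 'b pair_pre_digraph \<Rightarrow> ('a \<times> 'b) pair_pre_digraph"
    (infixr \<open>\<box>\<close> 70) where
  "G \<box> H = \<lparr> pverts = pverts G \<times> pverts H,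
     parcs = {((g, h), (g', h')) | g h g' h'.
       (g, h) \<in> pverts G \<times> pverts H \<and> (g', h') \<in> pverts G \<times> pverts H \<and>
       (g = g' \<and> (h, h') \<in> parcs H \<or> h = h' \<and> (g, g') \<in> parcs G)} \<rparr>"

lemma limited_dominating_set_pverts: "limited_dominating_set k G (pverts G)"
proof -
  have "open_neighborhood G u - pverts G = {}" for u
    by (auto simp: open_neighborhood_def)
  then show ?thesis
    unfolding limited_dominating_set_def dominating_set_def
    by (metis Diff_cancel card.empty empty_iff le0 order_refl)
qed

lemma pair_graph_cartesian_product:
  assumes "pair_graph G" "pair_graph H"
  shows "pair_graph (G \<box> H)"
proof -
  interpret G: pair_graph G by fact
  interpret H: pair_graph H by fact
  have fin: "finite (pverts (G \<box> H))"
    by (simp add: cartesian_product_def G.pair_finite_verts H.pair_finite_verts)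
  have sub: "parcs (G \<box> H) \<subseteq> pverts (G \<box> H) \<times> pverts (G \<box> H)"
    by (auto simp: cartesian_product_def)
  have "finite (parcs (G \<box> H))"
    using fin sub by (meson finite_SigmaI finite_subset)
  moreover have "symmetric (with_proj (G \<box> H))"
    using G.pair_sym_arcs H.pair_sym_arcs
    by (auto simp: symmetric_def cartesian_product_def sym_def)
  moreover have "fst e \<noteq> snd e" if "e \<in> parcs (G \<box> H)" for e
    using that G.pair_no_loops H.pair_no_loops by (fastforce simp: cartesian_product_def)
  ultimately show ?thesis
    using fin sub by unfold_locales auto
qed

lemma complete_digraph_exists:
  assumes "finite A"
  shows "complete_digraph (card A)
    (with_proj \<lparr> pverts = A, parcs = {(u, v). u \<in> A \<and> v \<in> A \<and> u \<noteq> v} \<rparr>)"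
proof -
  have "finite {(u, v). u \<in> A \<and> v \<in> A \<and> u \<noteq> v}"
    by (rule finite_subset[of _ "A \<times> A"]) (use assms in auto)
  then show ?thesis
    using assms by (auto simp: complete_digraph_pair_def)
qed

end

theory Submission
  imports Defs
begin

text \<open>
  View the vertices as the cells of a \<open>(k + 2) \<times> (k + 2)\<close> grid, adjacent when they share a line.
  An empty row and an empty column would meet in an undominated cell, so, say, every row meets
  \<open>D\<close>. A row with a single cell of \<open>D\<close> gives that cell \<open>k + 1\<close> neighbours outside \<open>D\<close>, so every
  row has at least two cells in \<open>D\<close>. Two full columns attain the bound.
\<close>

lemma open_neighborhood_complete:
  assumes "complete_digraph m (with_proj G)" "complete_digraph n (with_proj H)"
    and "a \<in> pverts G" "b \<in> pverts H"
  shows "open_neighborhood (G \<box> H) (a, b) =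
    {a} \<times> (pverts H - {b}) \<union> (pverts G - {a}) \<times> {b}"
  using assms
  by (auto simp: open_neighborhood_def cartesian_product_def complete_digraph_pair_def)

lemma card_relation_ge:
  assumes "finite A" "finite D" "\<And>a. a \<in> A \<Longrightarrow> n \<le> card (D `` {a})"
  shows "n * card A \<le> card D"
proof -
  have fin: "finite (D `` {a})" for a
    using assms(2) by (rule finite_Image)
  have "n * card A = (\<Sum>a\<in>A. n)" by simp
  also have "\<dots> \<le> (\<Sum>a\<in>A. card (D `` {a}))"
    using assms(3) by (rule sum_mono)
  also have "\<dots> = card (SIGMA a:A. D `` {a})"
    using assms(1) fin by (simp add: card_SigmaI)
  also have "\<dots> \<le> card D"
    by (rule card_mono) (use assms(2) in auto)
  finally show ?thesis .
qed

text \<open>If \<open>b\<close> were alone in its row, the other \<open>card B - 1\<close> cells of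
  that row would all lie in \<open>N - D\<close>, which is too small for them. Keeping
  \<open>N\<close> abstract, in place of a neighbourhood, lets the same argument serve columns
  through the converse relation.\<close>

lemma two_le_card_Image:
  assumes "finite B" "D \<subseteq> A \<times> B" "(a, b) \<in> D" "finite N"
    and "{a} \<times> (B - {b}) \<subseteq> N" "card (N - D) + 1 < card B"
  shows "2 \<le> card (D `` {a})"
proof -
  have b: "b \<in> B" using assms(2,3) by auto
  have fin: "finite (D `` {a})"
    by (rule finite_subset[OF _ assms(1)]) (use assms(2) in auto)
  have "D `` {a} \<noteq> {b}"
  proof
    assume "D `` {a} = {b}"
    then have "{a} \<times> (B - {b}) \<subseteq> N - D" using assms(5) by auto
    then have "card ({a} \<times> (B - {b})) \<le> card (N - D)"
      using assms(4) by (intro card_mono) auto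
    then show False using assms(1,6) b by (simp add: card_cartesian_product)
  qed
  with assms(3) obtain b' where "b' \<noteq> b" "{b, b'} \<subseteq> D `` {a}" by blast
  then show ?thesis
    using card_mono[OF fin, of "{b, b'}"] by simp
qed

lemma limited_dominating_set_card_ge:
  assumes G: "complete_digraph (k + 2) (with_proj G)"
    and H: "complete_digraph (k + 2) (with_proj H)"
    and D: "limited_dominating_set k (G \<box> H) D"
  shows "2 * (k + 2) \<le> card D"
proof -
  let ?A = "pverts G" and ?B = "pverts H" and ?N = "open_neighborhood (G \<box> H)"
  have A: "finite ?A" "card ?A = k + 2" and B: "finite ?B" "card ?B = k + 2"
    using G H by (auto simp: complete_digraph_pair_def intro: card_ge_0_finite)
  have sub: "D \<subseteq> ?A \<times> ?B"
    and dom: "\<And>v. v \<in> ?A \<times> ?B - D \<Longrightarrow> \<exists>u\<in>D. u \<in> ?N v"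
    and lim: "\<And>u. u \<in> D \<Longrightarrow> card (?N u - D) \<le> k"
    using D unfolding limited_dominating_set_def dominating_set_def
    by (auto simp: cartesian_product_def)
  have finD: "finite D" using sub A B by (meson finite_SigmaI finite_subset)
  have N: "?N (a, b) = {a} \<times> (?B - {b}) \<union> (?A - {a}) \<times> {b}" if "(a, b) \<in> D" for a b
    using open_neighborhood_complete[OF G H] sub that by blast
  \<comment> \<open>\<open>Domain D\<close> consists of the rows that meet \<open>D\<close>, and
    \<open>Range D\<close> of the columns that do.\<close>
  have "?A \<subseteq> Domain D \<or> ?B \<subseteq> Range D"
  proof (rule ccontr)
    assume "\<not> ?thesis"
    then obtain a b where ab: "a \<in> ?A" "b \<in> ?B" "a \<notin> Domain D" "b \<notin> Range D" by blast
    then obtain u where "u \<in> D" "u \<in> ?N (a, b)" using dom[of "(a, b)"] by blast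
    \<comment> \<open>Every neighbour of \<open>(a, b)\<close> lies in row \<open>a\<close> or
      column \<open>b\<close>, and neither contains a cell of \<open>D\<close>.\<close>
    then show False
      using open_neighborhood_complete[OF G H ab(1,2)] ab(3,4) by auto
  qed
  then show ?thesis
  proof
    assume "?A \<subseteq> Domain D"
    have "2 \<le> card (D `` {a})" if "a \<in> ?A" for a
    proof -
      from that \<open>?A \<subseteq> Domain D\<close> obtain b where ab: "(a, b) \<in> D" by blast
      \<comment> \<open>The size condition holds because \<open>card (?N (a, b) - D) + 1\<close>
        \<le> \<open>k + 1\<close> < \<open>k + 2\<close>.\<close>
      show ?thesis
        by (rule two_le_card_Image[OF B(1) sub ab, of "?N (a, b)"])
          (use N[OF ab] lim[OF ab] A B in auto)
    qed
    then show ?thesis using card_relation_ge[OF A(1) finD] A(2) by metis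
  next
    assume "?B \<subseteq> Range D"
    \<comment> \<open>Transposing the grid turns columns of \<open>D\<close> into rows of
      \<open>D\<inverse>\<close>. The neighbourhood is transposed along with it, which preserves the
      number of its cells outside \<open>D\<close>.\<close>
    have "2 \<le> card (D\<inverse> `` {b})" if "b \<in> ?B" for b
    proof -
      from that \<open>?B \<subseteq> Range D\<close> obtain a where ab: "(a, b) \<in> D" by blast
      have "card ((?N (a, b))\<inverse> - D\<inverse>) = card (?N (a, b) - D)"
        by (subst card_inverse[symmetric]) (rule arg_cong[of _ _ card], blast)
      moreover have "D\<inverse> \<subseteq> ?B \<times> ?A" "(b, a) \<in> D\<inverse>" using sub ab by auto
      ultimately show ?thesis
        by (intro two_le_card_Image[OF A(1), of "D\<inverse>" ?B b a "(?N (a, b))\<inverse>"])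
          (use N[OF ab] lim[OF ab] A B in auto)
    qed
    then show ?thesis
      using card_relation_ge[of ?B "D\<inverse>"] B finD by (metis card_inverse finite_converse)
  qed
qed

text \<open>One full column already dominates, since it meets every row; the second lowers the
  number of outside neighbours of each chosen cell from \<open>k + 1\<close> to
  \<open>k\<close>.\<close>

lemma limited_dominating_set_two_columns:
  assumes G: "complete_digraph m (with_proj G)"
    and H: "complete_digraph (k + 2) (with_proj H)"
    and b: "b1 \<in> pverts H" "b2 \<in> pverts H" "b1 \<noteq> b2"
  shows "limited_dominating_set k (G \<box> H) (pverts G \<times> {b1, b2})"
proof -
  let ?D = "pverts G \<times> {b1, b2}" and ?N = "open_neighborhood (G \<box> H)"
  have B: "finite (pverts H)" "card (pverts H) = k + 2"
    using H by (auto simp: complete_digraph_pair_def intro: card_ge_0_finite)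
  have N: "?N (a, b) = {a} \<times> (pverts H - {b}) \<union> (pverts G - {a}) \<times> {b}"
    if "a \<in> pverts G" "b \<in> pverts H" for a b
    using open_neighborhood_complete[OF G H that] .
  have "dominating_set (G \<box> H) ?D"
    unfolding dominating_set_def
  proof (intro conjI ballI)
    show "?D \<subseteq> pverts (G \<box> H)" using b by (auto simp: cartesian_product_def)
    fix v assume "v \<in> pverts (G \<box> H) - ?D"
    then obtain a b where "v = (a, b)" "a \<in> pverts G" "b \<in> pverts H" "b \<noteq> b1"
      by (auto simp: cartesian_product_def)
    then show "\<exists>u\<in>?D. u \<in> ?N v"
      using N b by (intro bexI[of _ "(a, b1)"]) auto
  qed
  moreover have "card (?N u - ?D) \<le> k" if "u \<in> ?D" for u
  proof -
    from that obtain a c where u: "u = (a, c)" "a \<in> pverts G" "c \<in> {b1, b2}" by blast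
    \<comment> \<open>The neighbours of \<open>u\<close> in its own column belong to
      \<open>?D\<close>, so only cells of row \<open>a\<close> remain.\<close>
    then have "?N u - ?D = {a} \<times> (pverts H - {b1, b2})" using N b by auto
    also have "card \<dots> = k"
      using B b by (simp add: card_cartesian_product card_Diff_subset)
    finally show ?thesis by simp
  qed
  ultimately show ?thesis unfolding limited_dominating_set_def by blast
qed

theorem proposition8:
  fixes k :: nat
    and G :: "'a pair_pre_digraph"
    and H :: "'b pair_pre_digraph"
  assumes "k > 0"
    and "complete_digraph (k + 2) (with_proj G)"
    and "complete_digraph (k + 2) (with_proj H)"
  shows "limited_domination_number k (G \<box> H) = 2 * (k + 2)"
  unfolding limited_domination_number_def
proof (rule Least_equality)
  have "card (pverts G) = k + 2" "2 \<le> card (pverts H)"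
    using assms(2,3) by (auto simp: complete_digraph_pair_def)
  moreover from this obtain b1 b2 where b: "b1 \<in> pverts H" "b2 \<in> pverts H" "b1 \<noteq> b2"
    by (auto simp: numeral_2_eq_2 card_le_Suc_iff)
  ultimately have "card (pverts G \<times> {b1, b2}) = 2 * (k + 2)"
    by (simp add: card_cartesian_product)
  then show "\<exists>D. limited_dominating_set k (G \<box> H) D \<and> card D = 2 * (k + 2)"
    using limited_dominating_set_two_columns[OF assms(2,3) b] by blast
qed (use limited_dominating_set_card_ge[OF assms(2,3)] in blast)

end
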